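(* Let $n\ge 2$ and let $m_1<\cdots<m_n$ be an arithmetic sequence of positive integers, i.e. $m_i=m_1+(i-1)d$ for all $i\in\{1,\ldots,n\}$ with $d\in\mathbb{Z}^+$, and suppose $\gcd\{m_1,d\}=1$. Let $q\in\mathbb{N}$ and $r\in\{1,\ldots,n-1\}$ be such that $m_1=q(n-1)+r$, and set $\alpha:=q+d$ and $k:=n-r$. Then the Hilbert series of $K[\mathcal{C}]$ is $$\mathcal{H}_{K[\mathcal{C}]}(t)=\frac{1+(n-1)(t+\cdots+t^{\alpha})+(n-1-k)t^{\alpha+1}}{(1-t)^2}.$$
   Context: $K$ is an infinite field, $R=K[x_1,\ldots,x_{n+1}]$ with its standard grading, and $0\in\mathbb{N}$. For positive integers $m_1<\cdots<m_n$, the associated projective monomial curve $\mathcal{C}\subset\mathbb{P}^n_K$ is parametrically defined by $x_i=u^{m_i}v^{m_n-m_i}$ for $1\le i\le n$ and $x_{n+1}=v^{m_n}$. Its vanishing ideal $I(\mathcal{C})\subset R$ is the kernel of the $K$-algebra homomorphism $R\to K[u,v]$, $x_i\mapsto u^{m_i}v^{m_n-m_i}$ ($1\le i\le n$), $x_{n+1}\mapsto v^{m_n}$ (a homogeneous ideal), and $K[\mathcal{C}]=R/I(\mathcal{C})$. The Hilbert function is $HF_{K[\mathcal{C}]}(s)=\dim_K(R_s/(I(\mathcal{C})\cap R_s))$, where $R_s$ is the space of homogeneous polynomials of degree $s$, and the Hilbert series is $\mathcal{H}_{K[\mathcal{C}]}(t)=\sum_{s\in\mathbb{N}}HF_{K[\mathcal{C}]}(s)\,t^s$.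 *)

theory Defs
  imports
    "HOL-Library.Poly_Mapping"
    "HOL-Computational_Algebra.Formal_Power_Series"
    "HOL-Algebra.AbelCoset"
    "Jordan_Normal_Form.VS_Connect"
begin

text \<open>
  Polynomials over \<open>'k\<close> with variables indexed by \<open>'x\<close>: a monomial is its finitely supported
  exponent vector, and a polynomial is a finitely supported map from monomials to coefficients.
\<close>

type_synonym ('x, 'k) mpoly = "('x \<Rightarrow>\<^sub>0 nat) \<Rightarrow>\<^sub>0 'k"

definition mvar :: "'x \<Rightarrow> ('x, 'k::field) mpoly" where
  "mvar i = Poly_Mapping.single (Poly_Mapping.single i 1) 1"

definition mconst :: "'k::field \<Rightarrow> ('x, 'k) mpoly" where
  "mconst c = Poly_Mapping.single 0 c"

definition mon_degree :: "('x \<Rightarrow>\<^sub>0 nat) \<Rightarrow> nat" where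
  "mon_degree e = (\<Sum>i\<in>Poly_Mapping.keys e. Poly_Mapping.lookup e i)"

text \<open>The \<open>'k\<close>-algebra homomorphism sending each variable \<open>i\<close> to \<open>f i\<close>.\<close>

definition msubst ::
  "('x \<Rightarrow> ('y, 'k::field) mpoly) \<Rightarrow> ('x, 'k) mpoly \<Rightarrow> ('y, 'k) mpoly" where
  "msubst f p = (\<Sum>e\<in>Poly_Mapping.keys p. mconst (Poly_Mapping.lookup p e) *
     (\<Prod>i\<in>Poly_Mapping.keys e. f i ^ Poly_Mapping.lookup e i))"

text \<open>
  \<open>R = K[x\<^sub>1, \<dots>, x\<^sub>n\<^sub>+\<^sub>1]\<close>, as the subring of \<open>(nat, 'k) mpoly\<close> of the polynomials in which only
  the variables with index in \<open>{1..n+1}\<close> occur, and its degree \<open>s\<close> component \<open>R\<^sub>s\<close> (which contains \<open>0\<close>).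
\<close>

definition polyring :: "nat \<Rightarrow> (nat, 'k::field) mpoly set" where
  "polyring n = {p. \<forall>e\<in>Poly_Mapping.keys p. Poly_Mapping.keys e \<subseteq> {1..n+1}}"

definition homogeneous_part :: "nat \<Rightarrow> nat \<Rightarrow> (nat, 'k::field) mpoly set" where
  "homogeneous_part n s = {p \<in> polyring n. \<forall>e\<in>Poly_Mapping.keys p. mon_degree e = s}"

datatype uv = U | V

text \<open>The image of \<open>x\<^sub>i\<close>, for \<open>i \<in> {1..n+1}\<close>; other indices do not occur in \<open>polyring n\<close>.\<close>

definition curve_param :: "nat \<Rightarrow> (nat \<Rightarrow> nat) \<Rightarrow> nat \<Rightarrow> (uv, 'k::field) mpoly" where
  "curve_param n m i =
     (if i \<le> n then mvar U ^ m i * mvar V ^ (m n - m i) else mvar V ^ m n)"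

definition curve_ideal :: "nat \<Rightarrow> (nat \<Rightarrow> nat) \<Rightarrow> (nat, 'k::field) mpoly set" where
  "curve_ideal n m = {p \<in> polyring n. msubst (curve_param n m) p = 0}"

text \<open>
  The quotient of a module \<open>M\<close> by a submodule \<open>N\<close>, carried by the cosets of \<open>N\<close>. The fields
  \<open>mult\<close> and \<open>one\<close> of the record play no role in modules.
\<close>

definition quotient_module ::
  "('r, 'v, 'c) module_scheme \<Rightarrow> 'v set \<Rightarrow> ('r, 'v set) module" where
  "quotient_module M N =
     \<lparr>carrier = a_rcosets\<^bsub>M\<^esub> N, mult = undefined, one = undefined,
      zero = N, add = set_add M,
      smult = (\<lambda>c X. \<Union>x\<in>X. N +>\<^bsub>M\<^esub> (c \<odot>\<^bsub>M\<^esub> x))\<rparr>"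

definition homogeneous_space :: "nat \<Rightarrow> nat \<Rightarrow> ('k::field, (nat, 'k) mpoly) module" where
  "homogeneous_space n s =
     \<lparr>carrier = homogeneous_part n s, mult = (*), one = 1, zero = 0, add = (+),
      smult = (\<lambda>c p. mconst c * p)\<rparr>"

text \<open>Hilbert function and Hilbert series of \<open>R / I\<close> for a homogeneous ideal \<open>I\<close> of \<open>R\<close>.\<close>

definition hilbert_function :: "nat \<Rightarrow> (nat, 'k::field) mpoly set \<Rightarrow> nat \<Rightarrow> nat" where
  "hilbert_function n I s = vectorspace.dim class_ring
     (quotient_module (homogeneous_space n s) (I \<inter> homogeneous_part n s))"

definition hilbert_series :: "nat \<Rightarrow> (nat, 'k::field) mpoly set \<Rightarrow> rat fps" where
  "hilbert_series n I = Abs_fps (\<lambda>s. of_nat (hilbert_function n I s))"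

end

theory Submission
  imports Defs
begin

text \<open>
  A monomial of degree \<open>s\<close> maps to \<open>u\<^sup>w v\<^bsup>s m\<^sub>n - w\<^esup>\<close>, so the Hilbert function at \<open>s\<close> counts the
  weights \<open>w\<close> that occur, namely the numbers \<open>j m\<^sub>1 + l d\<close> with \<open>j \<le> s\<close> and \<open>l \<le> j (n - 1)\<close>.
  As \<open>m\<^sub>1\<close> and \<open>d\<close> are coprime, two such representations differ by a multiple of \<open>(d, - m\<^sub>1)\<close>, and each
  weight is counted once by its representation with least \<open>j\<close>. There are \<open>j (n - 1) + 1\<close> of these
  if \<open>j \<le> \<alpha>\<close> and \<open>\<alpha> (n - 1) + r\<close> otherwise, and differencing this sequence gives the numerator.
\<close>

section \<open>Quotient modules and the first isomorphism theorem\<close>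

lemma quotient_module_simps:
  "carrier (quotient_module M N) = a_rcosets\<^bsub>M\<^esub> N"
  "\<zero>\<^bsub>quotient_module M N\<^esub> = N"
  "X \<oplus>\<^bsub>quotient_module M N\<^esub> Y = X <+>\<^bsub>M\<^esub> Y"
  "c \<odot>\<^bsub>quotient_module M N\<^esub> X = (\<Union>x\<in>X. N +>\<^bsub>M\<^esub> (c \<odot>\<^bsub>M\<^esub> x))"
  by (simp_all add: quotient_module_def)

context submodule
begin

lemma abelian_subgroup: "abelian_subgroup N M"
proof -
  interpret M: module R M by (rule module)
  show ?thesis
  proof (rule abelian_subgroupI3)
    show "additive_subgroup N M"
    proof (rule additive_subgroupI, rule subgroup.intro)
      fix x assume "x \<in> N"
      \<comment> \<open>Closure under negation comes from scalar multiplication by -1.\<close>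
      then have "(\<ominus>\<^bsub>R\<^esub> \<one>\<^bsub>R\<^esub>) \<odot> x \<in> N" by simp
      then have "\<ominus> x \<in> N" using subset \<open>x \<in> N\<close> by (simp add: M.smult_minus_1 subsetD)
      then show "inv\<^bsub>add_monoid M\<^esub> x \<in> N" by (simp add: a_inv_def)
    qed (use subset in auto)
  qed (rule M.M.abelian_group_axioms)
qed

text \<open>Representatives of one coset differ by an element of \<open>N\<close>, and so do their
  multiples by \<open>c\<close>. Hence all cosets in the union that defines the scalar
  multiplication coincide, and the union collapses to one of them.\<close>

lemma smult_coset:
  assumes "c \<in> carrier R" "x \<in> carrier M"
  shows "c \<odot>\<^bsub>quotient_module M N\<^esub> (N +>\<^bsub>M\<^esub> x) = N +>\<^bsub>M\<^esub> (c \<odot> x)"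
proof -
  interpret M: module R M by (rule module)
  interpret N: abelian_subgroup N M by (rule abelian_subgroup)
  have "N +> (c \<odot> y) = N +> (c \<odot> x)" if "y \<in> N +> x" for y
  proof -
    from that obtain h where h: "h \<in> N" "y = h \<oplus> x"
      by (auto simp: a_r_coset_def')
    then have "c \<odot> y = c \<odot> h \<oplus> c \<odot> x"
      using assms subset by (simp add: M.smult_r_distr subsetD)
    then have "c \<odot> y \<in> N +> (c \<odot> x)"
      using h assms by (auto simp: a_r_coset_def')
    then show ?thesis
      by (rule N.a_repr_independence'[symmetric]) (use assms in simp)
  qed
  moreover have "x \<in> N +> x" using assms(2) by (rule N.a_rcos_self)
  ultimately show ?thesis unfolding quotient_module_simps by (intro UN_constant_eq) blast+
qed

lemma add_coset:
  assumes "x \<in> carrier M" "y \<in> carrier M"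
  shows "(N +>\<^bsub>M\<^esub> x) \<oplus>\<^bsub>quotient_module M N\<^esub> (N +>\<^bsub>M\<^esub> y) = N +>\<^bsub>M\<^esub> (x \<oplus> y)"
proof -
  interpret N: abelian_subgroup N M by (rule abelian_subgroup)
  show ?thesis using assms by (simp add: quotient_module_simps N.a_rcos_sum)
qed

lemma carrier_quotient_module: "carrier (quotient_module M N) = (\<lambda>x. N +>\<^bsub>M\<^esub> x) ` carrier M"
  by (auto simp: quotient_module_simps A_RCOSETS_def')

lemma zero_quotient_module: "\<zero>\<^bsub>quotient_module M N\<^esub> = N +>\<^bsub>M\<^esub> \<zero>"
proof -
  interpret M: module R M by (rule module)
  show ?thesis using subset by (simp add: quotient_module_simps)
qed

lemma coset_eq_iff:
  assumes "x \<in> carrier M" "y \<in> carrier M"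
  shows "N +>\<^bsub>M\<^esub> x = N +>\<^bsub>M\<^esub> y \<longleftrightarrow> x \<ominus> y \<in> N"
proof -
  interpret M: module R M by (rule module)
  interpret N: abelian_subgroup N M by (rule abelian_subgroup)
  have "N +> x = N +> y \<longleftrightarrow> x \<in> N +> y"
    using N.a_rcos_self[OF assms(1)] N.a_repr_independence'[OF _ assms(2), of x] by blast
  then show ?thesis
    using assms by (simp add: N.a_rcos_module a_minus_def)
qed

text \<open>Once every element is written as a coset of a representative, each module axiom is the
  axiom of \<open>M\<close> for the representatives.\<close>

lemma module_quotient_module: "module R (quotient_module M N)"
proof -
  interpret M: module R M by (rule module)
  note simps = carrier_quotient_module zero_quotient_module add_coset smult_coset
  show ?thesis
  proof (rule module_criteria; (intro allI ballI impI)?)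
    show "\<exists>w\<in>carrier (quotient_module M N). v \<oplus>\<^bsub>quotient_module M N\<^esub> w = \<zero>\<^bsub>quotient_module M N\<^esub>"
      if v: "v \<in> carrier (quotient_module M N)" for v
    proof -
      from v obtain x where "x \<in> carrier M" "v = N +> x" by (auto simp: simps)
      then show ?thesis
        by (intro bexI[of _ "N +> (\<ominus> x)"]) (auto simp: simps M.M.r_neg)
    qed
  qed (use M.R.cring_axioms in \<open>(clarsimp simp: simps M.M.a_ac M.smult_assoc1 M.smult_l_distr
      M.smult_r_distr)+\<close>)
qed

end

text \<open>First isomorphism theorem, with the isomorphism built from \<open>W\<close> to the
  quotient rather than the other way, since comparing dimensions along a bijective linear map uses
  finite dimension of its source, and this is assumed for \<open>W\<close>.\<close>

lemma (in linear_map) dim_quotient_kernel: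
  assumes fin: "W.fin_dim" and surj: "T ` carrier V = carrier W"
  shows "vectorspace.dim K (quotient_module V kerT) = W.dim"
proof -
  let ?Q = "quotient_module V kerT"
  note N = ker_is_submodule
  have Q: "vectorspace K ?Q"
    by (intro vectorspace.intro submodule.module_quotient_module[OF N] V.field.field_axioms)
  have eq_iff: "kerT +>\<^bsub>V\<^esub> x = kerT +>\<^bsub>V\<^esub> y \<longleftrightarrow> T x = T y"
    if "x \<in> carrier V" "y \<in> carrier V" for x y
  proof -
    have "x \<ominus>\<^bsub>V\<^esub> y \<in> kerT \<longleftrightarrow> T x \<ominus>\<^bsub>W\<^esub> T y = \<zero>\<^bsub>W\<^esub>"
      using that by (simp add: ker_def)
    also have "\<dots> \<longleftrightarrow> T x = T y"
      using that W.module.M.minus_other_side[OF T_im T_im] by blast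
    finally show ?thesis using that by (simp add: submodule.coset_eq_iff[OF N])
  qed
  \<comment> \<open>\<open>inv_into\<close> picks some preimage of \<open>w\<close>; by
    \<open>S_T\<close> any other preimage gives the same coset, which makes \<open>S\<close> linear
    although the choice is not.\<close>
  define S where "S w = kerT +>\<^bsub>V\<^esub> inv_into (carrier V) T w" for w
  have pre: "inv_into (carrier V) T w \<in> carrier V" "T (inv_into (carrier V) T w) = w"
    if "w \<in> carrier W" for w
    using that unfolding surj[symmetric] by (rule inv_into_into, rule f_inv_into_f)
  have S_T: "S (T x) = kerT +>\<^bsub>V\<^esub> x" if "x \<in> carrier V" for x
    unfolding S_def using that pre[OF T_im[OF that]] by (subst eq_iff)
  have "S \<in> module_hom K W ?Q"
    unfolding module_hom_def
  proof (intro CollectI conjI allI impI funcsetI; (elim conjE)?)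
    show "S (v \<oplus>\<^bsub>W\<^esub> w) = S v \<oplus>\<^bsub>?Q\<^esub> S w" if vw: "v \<in> carrier W" "w \<in> carrier W" for v w
    proof -
      from vw surj obtain x y where "x \<in> carrier V" "v = T x" "y \<in> carrier V" "w = T y"
        by (metis imageE)
      then show ?thesis
        using S_T[of "x \<oplus>\<^bsub>V\<^esub> y"] by (simp add: submodule.add_coset[OF N] S_T)
    qed
    show "S (c \<odot>\<^bsub>W\<^esub> w) = c \<odot>\<^bsub>?Q\<^esub> S w" if cw: "c \<in> carrier K" "w \<in> carrier W" for c w
    proof -
      from cw surj obtain x where "x \<in> carrier V" "w = T x" by (metis imageE)
      then show ?thesis
        using cw S_T[of "c \<odot>\<^bsub>V\<^esub> x"] by (simp add: submodule.smult_coset[OF N] S_T)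
    qed
    show "S w \<in> carrier ?Q" if "w \<in> carrier W" for w
      unfolding S_def using pre(1)[OF that] by (simp add: submodule.carrier_quotient_module[OF N])
  qed
  then have S: "linear_map K W ?Q S"
    using Q W.vectorspace_axioms
    by (intro linear_map.intro mod_hom.intro mod_hom_axioms.intro) (simp_all add: vectorspace_def)
  have "inj_on S (carrier W)"
  proof (rule inj_onI)
    fix v w assume "v \<in> carrier W" "w \<in> carrier W" "S v = S w"
    then have "T (inv_into (carrier V) T v) = T (inv_into (carrier V) T w)"
      using eq_iff[of "inv_into (carrier V) T v" "inv_into (carrier V) T w"] pre(1)
      unfolding S_def by blast
    then show "v = w" using pre(2) \<open>v \<in> carrier W\<close> \<open>w \<in> carrier W\<close> by metis
  qed
  moreover have "S ` carrier W = carrier ?Q"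
    unfolding submodule.carrier_quotient_module[OF N] surj[symmetric] image_image
    by (intro image_cong refl S_T)
  ultimately show ?thesis using linear_map.dim_eq[OF S fin] by simp
qed

section \<open>Spaces of polynomials spanned by a set of monomials\<close>

text \<open>One construction serves both sides of the parametrization: the homogeneous component of
  degree \<open>s\<close> as source, and the span of the image monomials as target.\<close>

definition supported_space :: "('x \<Rightarrow>\<^sub>0 nat) set \<Rightarrow> ('k::field, ('x, 'k) mpoly) module" where
  "supported_space B =
     \<lparr>carrier = {p. Poly_Mapping.keys p \<subseteq> B}, mult = (*), one = 1, zero = 0, add = (+),
      smult = (\<lambda>c p. mconst c * p)\<rparr>"

lemma supported_space_simps [simp]:
  "carrier (supported_space B) = {p. Poly_Mapping.keys p \<subseteq> B}"
  "\<zero>\<^bsub>supported_space B\<^esub> = 0"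
  "p \<oplus>\<^bsub>supported_space B\<^esub> q = p + q"
  "c \<odot>\<^bsub>supported_space B\<^esub> p = mconst c * p"
  by (simp_all add: supported_space_def)

lemma mconst_0 [simp]: "mconst 0 = 0"
  and mconst_1 [simp]: "mconst 1 = 1"
  and mconst_add: "mconst (a + b) = mconst a + mconst b"
  and mconst_mult: "mconst (a * b) = mconst a * mconst b"
  by (simp_all add: mconst_def single_add mult_single)

lemma mconst_mult_single: "mconst c * Poly_Mapping.single e a = Poly_Mapping.single e (c * a)"
  by (simp add: mconst_def mult_single)

lemma lookup_mconst_mult:
  "Poly_Mapping.lookup (mconst c * p) e = c * Poly_Mapping.lookup p e"
  unfolding mconst_def mult_map_scale_conv_mult[symmetric] map.rep_eq by (simp add: when_def)

lemma keys_mconst_mult: "Poly_Mapping.keys (mconst c * p) \<subseteq> Poly_Mapping.keys p"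
  by (auto simp: in_keys_iff lookup_mconst_mult)

lemma sum_single_lookup:
  assumes "finite B" "Poly_Mapping.keys p \<subseteq> B"
  shows "(\<Sum>b\<in>B. Poly_Mapping.single b (Poly_Mapping.lookup p b)) = p"
proof (rule poly_mapping_eqI)
  fix e
  have "(\<Sum>b\<in>B. Poly_Mapping.lookup (Poly_Mapping.single b (Poly_Mapping.lookup p b)) e)
      = (\<Sum>b\<in>B. if b = e then Poly_Mapping.lookup p e else 0)"
    by (intro sum.cong) (auto simp: lookup_single)
  also have "\<dots> = Poly_Mapping.lookup p e"
    using assms by (auto simp: in_keys_iff)
  finally show "Poly_Mapping.lookup (\<Sum>b\<in>B. Poly_Mapping.single b (Poly_Mapping.lookup p b)) e
      = Poly_Mapping.lookup p e"
    by (simp add: lookup_sum)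
qed

lemma keys_sum_single:
  "Poly_Mapping.keys (\<Sum>x\<in>A. Poly_Mapping.single (h x) (c x)) \<subseteq> h ` A"
proof -
  have "(\<Union>x\<in>A. Poly_Mapping.keys (Poly_Mapping.single (h x) (c x))) \<subseteq> h ` A"
    by auto
  then show ?thesis by (rule order.trans[OF keys_sum])
qed

lemma vectorspace_supported_space:
  "vectorspace class_ring (supported_space B :: ('k::field, ('x, 'k) mpoly) module)"
proof (rule vs_criteria)
  show "\<forall>v\<in>carrier (supported_space B). \<exists>w\<in>carrier (supported_space B :: ('k, ('x, 'k) mpoly) module).
      v \<oplus>\<^bsub>supported_space B\<^esub> w = \<zero>\<^bsub>supported_space B\<^esub>"
  proof
    fix v :: "('x, 'k) mpoly" assume "v \<in> carrier (supported_space B)"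
    then show "\<exists>w\<in>carrier (supported_space B :: ('k, ('x, 'k) mpoly) module).
        v \<oplus>\<^bsub>supported_space B\<^esub> w = \<zero>\<^bsub>supported_space B\<^esub>"
      by (intro bexI[of _ "- v"]) simp_all
  qed
  show "\<forall>v w. v \<in> carrier (supported_space B) \<and> w \<in> carrier (supported_space B) \<longrightarrow>
      v \<oplus>\<^bsub>supported_space B\<^esub> w \<in> carrier (supported_space B :: ('k, ('x, 'k) mpoly) module)"
    by (auto dest: subsetD[OF keys_add])
  show "\<forall>c v. c \<in> carrier class_ring \<and> v \<in> carrier (supported_space B) \<longrightarrow>
      c \<odot>\<^bsub>supported_space B\<^esub> v \<in> carrier (supported_space B :: ('k, ('x, 'k) mpoly) module)"
    by (auto dest: subsetD[OF keys_mconst_mult])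
qed (rule class_field, simp_all add: mconst_add mconst_mult algebra_simps)

text \<open>Lets linear combinations in the module be computed as ordinary sums of
  polynomials.\<close>

lemma finsum_supported_space:
  fixes h :: "'a \<Rightarrow> ('x, 'k::field) mpoly"
  assumes "\<And>x. x \<in> A \<Longrightarrow> Poly_Mapping.keys (h x) \<subseteq> B"
  shows "finsum (supported_space B) h A = sum h A"
proof -
  interpret vectorspace class_ring "supported_space B :: ('k, ('x, 'k) mpoly) module"
    by (rule vectorspace_supported_space)
  show ?thesis using assms
  proof (induction A rule: infinite_finite_induct)
    case (insert x A)
    then have "finsum (supported_space B) h (insert x A)
        = h x \<oplus>\<^bsub>supported_space B\<^esub> finsum (supported_space B) h A"
      by (intro finsum_insert) auto
    with insert show ?case by simp
  qed simp_all
qed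

text \<open>The monomials with exponent in \<open>B\<close> form a basis: a polynomial is the sum of
  its terms, and its coefficients are determined by it.\<close>

lemma supported_space_dim:
  fixes B :: "('x \<Rightarrow>\<^sub>0 nat) set"
  assumes "finite B"
  defines "W \<equiv> supported_space B :: ('k::field, ('x, 'k) mpoly) module"
  shows "vectorspace.fin_dim class_ring W" "vectorspace.dim class_ring W = card B"
proof -
  interpret vectorspace class_ring W
    unfolding W_def by (rule vectorspace_supported_space)
  let ?m = "\<lambda>b. Poly_Mapping.single b (1 :: 'k)"
  let ?S = "?m ` B"
  have inj: "inj_on ?m X" for X
    by (rule inj_onI) (metis lookup_single_eq lookup_single_not_eq zero_neq_one)
  have inv: "inv_into UNIV ?m (?m b) = b" for b
    by (rule inv_into_f_f[OF inj UNIV_I])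
  have lincomb: "lincomb a ?S = (\<Sum>b\<in>B. Poly_Mapping.single b (a (?m b)))" for a
  proof -
    have "lincomb a ?S = (\<Sum>v\<in>?S. mconst (a v) * v)"
      unfolding lincomb_def unfolding W_def
      by (subst finsum_supported_space) (auto simp: mconst_mult_single split: if_splits)
    also have "\<dots> = (\<Sum>b\<in>B. Poly_Mapping.single b (a (?m b)))"
      by (simp add: sum.reindex[OF inj] mconst_mult_single)
    finally show ?thesis .
  qed
  have S: "finite ?S" "?S \<subseteq> carrier W"
    using assms by (auto simp: W_def)
  have "p \<in> span ?S" if "p \<in> carrier W" for p
  proof -
    \<comment> \<open>Coefficients of a linear combination are indexed by basis vectors, so the
      exponent is first recovered from the monomial.\<close>
    let ?a = "Poly_Mapping.lookup p \<circ> inv_into UNIV ?m"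
    have "lincomb ?a ?S = (\<Sum>b\<in>B. Poly_Mapping.single b (Poly_Mapping.lookup p b))"
      by (simp add: lincomb inv)
    also have "\<dots> = p"
      using that \<open>finite B\<close> by (intro sum_single_lookup) (simp_all add: W_def)
    finally have "p = lincomb ?a ?S" ..
    then show ?thesis
      unfolding finite_span[OF S] by (intro CollectI exI[of _ ?a] conjI) simp_all
  qed
  then have gen: "gen_set ?S"
    using span_closed[OF S(2)] by blast
  have "lin_indpt ?S"
  proof (rule finite_lin_indpt2[OF S])
    fix a assume "lincomb a ?S = \<zero>\<^bsub>W\<^esub>"
    then have "(\<Sum>b\<in>B. Poly_Mapping.single b (a (?m b))) = 0"
      by (simp add: lincomb) (simp add: W_def)
    then have "(\<Sum>b\<in>B. Poly_Mapping.lookup (Poly_Mapping.single b (a (?m b))) e) = 0" for e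
      by (simp flip: lookup_sum)
    moreover have "(\<Sum>b\<in>B. Poly_Mapping.lookup (Poly_Mapping.single b (a (?m b))) e) = a (?m e)"
      if "e \<in> B" for e
    proof -
      have "(\<Sum>b\<in>B. Poly_Mapping.lookup (Poly_Mapping.single b (a (?m b))) e)
          = (\<Sum>b\<in>B. if b = e then a (?m e) else 0)"
        by (intro sum.cong) (auto simp: lookup_single)
      then show ?thesis using that \<open>finite B\<close> by simp
    qed
    ultimately show "\<forall>v\<in>?S. a v = \<zero>\<^bsub>class_ring\<^esub>" by auto
  qed
  then have "basis ?S" using gen S by (simp add: basis_def)
  then show "dim = card B" using S(1) card_image[OF inj] by (simp add: dim_basis)
  show "fin_dim" using gen S by (auto simp: fin_dim_def)
qed

section \<open>Substitution of monomials for variables\<close>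

lemma msubst_add: "msubst f (p + q) = msubst f p + msubst f q"
  unfolding msubst_def
  by (rule setsum_keys_plus_distrib) (simp_all add: mconst_add algebra_simps)

lemma msubst_single:
  "msubst f (Poly_Mapping.single e c) =
     mconst c * (\<Prod>i\<in>Poly_Mapping.keys e. f i ^ Poly_Mapping.lookup e i)"
  by (simp add: msubst_def)

lemma msubst_sum: "msubst f (sum h A) = (\<Sum>x\<in>A. msubst f (h x))"
proof -
  have "msubst f 0 = 0" by (simp add: msubst_def)
  then show ?thesis
    by (induction A rule: infinite_finite_induct) (auto simp: msubst_add)
qed

lemma msubst_mconst_mult: "msubst f (mconst c * p) = mconst c * msubst f p"
proof (cases "c = 0")
  \<comment> \<open>Multiplying by a nonzero constant keeps the support, so both sums run over the
    same exponents.\<close>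
  case False
  then have "Poly_Mapping.keys (mconst c * p) = Poly_Mapping.keys p"
    by (auto simp: in_keys_iff lookup_mconst_mult)
  then show ?thesis
    by (simp add: msubst_def lookup_mconst_mult mconst_mult sum_distrib_left mult.assoc)
qed (simp add: msubst_def)

lemma dim_quotient_msubst_kernel:
  fixes f :: "'x \<Rightarrow> ('y, 'k::field) mpoly" and E :: "('x \<Rightarrow>\<^sub>0 nat) set"
  assumes mono: "\<And>e. e \<in> E \<Longrightarrow>
      (\<Prod>i\<in>Poly_Mapping.keys e. f i ^ Poly_Mapping.lookup e i) = Poly_Mapping.single (g e) 1"
    and fin: "finite (g ` E)"
  shows "vectorspace.dim class_ring (quotient_module (supported_space E)
      {p. Poly_Mapping.keys p \<subseteq> E \<and> msubst f p = 0}) = card (g ` E)"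
proof -
  let ?V = "supported_space E :: ('k, ('x, 'k) mpoly) module"
  let ?W = "supported_space (g ` E) :: ('k, ('y, 'k) mpoly) module"
  have single: "msubst f (Poly_Mapping.single e c) = Poly_Mapping.single (g e) c" if "e \<in> E" for e c
    using that by (simp add: msubst_single mono mconst_mult_single)
  have keys: "Poly_Mapping.keys (msubst f p) \<subseteq> g ` E" if "Poly_Mapping.keys p \<subseteq> E" for p
  proof -
    have "msubst f p = (\<Sum>e\<in>Poly_Mapping.keys p. Poly_Mapping.single (g e) (Poly_Mapping.lookup p e))"
      unfolding msubst_def using that by (intro sum.cong) (auto simp: mono mconst_mult_single)
    then have "Poly_Mapping.keys (msubst f p) \<subseteq> g ` Poly_Mapping.keys p"
      by (simp only: keys_sum_single)
    then show ?thesis using that by blast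
  qed
  have hom: "msubst f \<in> module_hom class_ring ?V ?W"
    using keys by (auto simp: module_hom_def msubst_add msubst_mconst_mult)
  have lin: "linear_map class_ring ?V ?W (msubst f)"
    using vectorspace_supported_space[where 'k = 'k and B = E]
      vectorspace_supported_space[where 'k = 'k and B = "g ` E"] hom
    by (intro linear_map.intro mod_hom.intro mod_hom_axioms.intro) (simp_all add: vectorspace_def)
  have surj: "msubst f ` carrier ?V = carrier ?W"
  proof
    show "carrier ?W \<subseteq> msubst f ` carrier ?V"
    proof
      fix q assume "q \<in> carrier ?W"
      \<comment> \<open>A section of \<open>g\<close>: one preimage monomial for each image monomial
        lifts \<open>q\<close> term by term.\<close>
      define h where "h = inv_into E g"
      have h: "h b \<in> E" "g (h b) = b" if "b \<in> g ` E" for b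
        using that by (auto simp: h_def inv_into_into f_inv_into_f)
      define p where "p = (\<Sum>b\<in>g ` E. Poly_Mapping.single (h b) (Poly_Mapping.lookup q b))"
      have "msubst f p = (\<Sum>b\<in>g ` E. Poly_Mapping.single b (Poly_Mapping.lookup q b))"
        unfolding p_def msubst_sum using h by (intro sum.cong) (auto simp: single)
      also have "\<dots> = q"
        using \<open>q \<in> carrier ?W\<close> fin by (intro sum_single_lookup) simp_all
      finally have "msubst f p = q" .
      moreover have "Poly_Mapping.keys p \<subseteq> E"
        unfolding p_def using h(1) by (intro order.trans[OF keys_sum_single]) blast
      ultimately show "q \<in> msubst f ` carrier ?V" by auto
    qed
  qed (use keys in auto)
  have "mod_hom.ker ?V ?W (msubst f) = {p. Poly_Mapping.keys p \<subseteq> E \<and> msubst f p = 0}"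
    using lin by (subst mod_hom.ker_def[of class_ring]) (auto simp: linear_map_def)
  then show ?thesis
    using linear_map.dim_quotient_kernel[OF lin supported_space_dim(1)[OF fin] surj]
      supported_space_dim(2)[OF fin, where 'k = 'k] by simp
qed

section \<open>The Hilbert function of a monomial curve as a number of weights\<close>

lemma mvar_power: "mvar i ^ c = Poly_Mapping.single (Poly_Mapping.single i c) 1"
proof (induction c)
  case (Suc c)
  have "Poly_Mapping.single i (Suc c) = Poly_Mapping.single i 1 + Poly_Mapping.single i c"
    by (simp flip: single_add)
  then show ?case unfolding power_Suc Suc.IH unfolding mvar_def by (simp add: mult_single)
qed simp

lemma prod_single_one:
  "(\<Prod>i\<in>I. Poly_Mapping.single (h i) (1 :: 'k::field)) = Poly_Mapping.single (\<Sum>i\<in>I. h i) 1"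
  by (induction I rule: infinite_finite_induct) (auto simp: mult_single)

lemma curve_param_power:
  "curve_param n m i ^ c =
     Poly_Mapping.single (if i \<le> n
       then Poly_Mapping.single U (c * m i) + Poly_Mapping.single V (c * (m n - m i))
       else Poly_Mapping.single V (c * m n)) 1"
  by (simp add: curve_param_def power_mult_distrib flip: power_mult)
    (simp add: mvar_power mult_single mult.commute)

definition monomials :: "nat \<Rightarrow> nat \<Rightarrow> (nat \<Rightarrow>\<^sub>0 nat) set" where
  "monomials n s = {e. Poly_Mapping.keys e \<subseteq> {1..n+1} \<and> mon_degree e = s}"

text \<open>The exponent of \<open>U\<close> in the image of the monomial \<open>e\<close>. The last
  variable maps to a power of \<open>V\<close> alone, so the sum stops at \<open>n\<close>.\<close>

definition curve_weight :: "nat \<Rightarrow> (nat \<Rightarrow> nat) \<Rightarrow> (nat \<Rightarrow>\<^sub>0 nat) \<Rightarrow> nat" where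
  "curve_weight n m e = (\<Sum>i=1..n. Poly_Mapping.lookup e i * m i)"

lemma sum_keys_lookup:
  assumes "finite A" "Poly_Mapping.keys e \<subseteq> A"
  shows "(\<Sum>i\<in>Poly_Mapping.keys e. Poly_Mapping.lookup e i * h i)
    = (\<Sum>i\<in>A. Poly_Mapping.lookup e i * (h i :: nat))"
  using assms by (intro sum.mono_neutral_left) (auto simp: in_keys_iff)

lemma mon_degree_eq_sum:
  fixes e :: "nat \<Rightarrow>\<^sub>0 nat" and n :: nat
  assumes "Poly_Mapping.keys e \<subseteq> {1..n+1}"
  shows "mon_degree e = (\<Sum>i=1..n. Poly_Mapping.lookup e i) + Poly_Mapping.lookup e (n+1)"
proof -
  have "{1..n+1} = insert (n+1) {1..n}" by auto
  then show ?thesis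
    using sum_keys_lookup[OF finite_atLeastAtMost assms, of "\<lambda>_. 1"]
    by (simp add: mon_degree_def del: Suc_eq_plus1 One_nat_def)
qed

text \<open>Every variable maps to a monomial of degree \<open>m n\<close>, so the image of
  \<open>e\<close> has degree \<open>s * m n\<close>, and the exponent of \<open>U\<close>
  determines that of \<open>V\<close>.\<close>

lemma prod_curve_param:
  assumes e: "e \<in> monomials n s" and le: "\<And>i. i \<in> {1..n} \<Longrightarrow> m i \<le> m n"
  shows "(\<Prod>i\<in>Poly_Mapping.keys e. curve_param n m i ^ Poly_Mapping.lookup e i)
    = Poly_Mapping.single (Poly_Mapping.single U (curve_weight n m e)
        + Poly_Mapping.single V (s * m n - curve_weight n m e)) (1 :: 'k::field)"
proof -
  let ?c = "Poly_Mapping.lookup e"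
  let ?h = "\<lambda>i. if i \<le> n
       then Poly_Mapping.single U (?c i * m i) + Poly_Mapping.single V (?c i * (m n - m i))
       else Poly_Mapping.single V (?c i * m n)"
  have keys: "Poly_Mapping.keys e \<subseteq> {1..n+1}" and deg: "mon_degree e = s"
    using e by (auto simp: monomials_def)
  have "Poly_Mapping.lookup (\<Sum>i\<in>Poly_Mapping.keys e. ?h i) U
      = (\<Sum>i\<in>Poly_Mapping.keys e. ?c i * (if i \<le> n then m i else 0))"
    unfolding lookup_sum by (intro sum.cong) (auto simp: lookup_add lookup_single)
  then have U: "Poly_Mapping.lookup (\<Sum>i\<in>Poly_Mapping.keys e. ?h i) U = curve_weight n m e"
    unfolding sum_keys_lookup[OF finite_atLeastAtMost keys] by (simp add: curve_weight_def)
  \<comment> \<open>By \<open>le\<close> the subtraction \<open>m n - m i\<close> is not truncated,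
    so the two exponents contributed by each factor add up to a multiple of
    \<open>m n\<close>.\<close>
  have "Poly_Mapping.lookup (\<Sum>i\<in>Poly_Mapping.keys e. ?h i) U
      + Poly_Mapping.lookup (\<Sum>i\<in>Poly_Mapping.keys e. ?h i) V
      = (\<Sum>i\<in>Poly_Mapping.keys e. ?c i * m n)"
    unfolding lookup_sum sum.distrib[symmetric] using le keys
    by (intro sum.cong) (auto simp: lookup_add lookup_single simp flip: distrib_left)
  also have "\<dots> = s * m n"
    using deg by (simp add: mon_degree_def flip: sum_distrib_right)
  finally have V: "Poly_Mapping.lookup (\<Sum>i\<in>Poly_Mapping.keys e. ?h i) V
      = s * m n - curve_weight n m e"
    using U by simp
  have "(\<Sum>i\<in>Poly_Mapping.keys e. ?h i) = Poly_Mapping.single U (curve_weight n m e)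
        + Poly_Mapping.single V (s * m n - curve_weight n m e)"
  proof (rule poly_mapping_eqI)
    fix x show "Poly_Mapping.lookup (\<Sum>i\<in>Poly_Mapping.keys e. ?h i) x = Poly_Mapping.lookup
        (Poly_Mapping.single U (curve_weight n m e)
          + Poly_Mapping.single V (s * m n - curve_weight n m e)) x"
      by (cases x) (simp_all only: U V, simp_all add: lookup_add lookup_single)
  qed
  then show ?thesis
    by (simp only: curve_param_power prod_single_one)
qed

lemma curve_weight_le:
  assumes e: "e \<in> monomials n s" and le: "\<And>i. i \<in> {1..n} \<Longrightarrow> m i \<le> m n"
  shows "curve_weight n m e \<le> s * m n"
proof -
  have "curve_weight n m e \<le> (\<Sum>i=1..n. Poly_Mapping.lookup e i * m n)"
    unfolding curve_weight_def by (intro sum_mono mult_left_mono le) auto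
  also have "\<dots> \<le> mon_degree e * m n"
    using e mon_degree_eq_sum[of e n] by (simp add: monomials_def flip: sum_distrib_right)
  finally show ?thesis using e by (simp add: monomials_def)
qed

lemma hilbert_function_curve_ideal:
  assumes le: "\<And>i. i \<in> {1..n} \<Longrightarrow> m i \<le> m n"
  shows "hilbert_function n (curve_ideal n m :: (nat, 'k::field) mpoly set) s
    = card (curve_weight n m ` monomials n s)"
proof -
  \<comment> \<open>The image monomial of weight \<open>a\<close> in degree \<open>s\<close>. It is
    injective in \<open>a\<close>, so counting image monomials is counting weights.\<close>
  define g where "g a = Poly_Mapping.single U a + Poly_Mapping.single V (s * m n - a)" for a
  have "Poly_Mapping.lookup (g a) U = a" for a
    by (simp add: g_def lookup_add lookup_single)
  then have inj: "inj g" by (metis injI)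
  let ?w = "curve_weight n m ` monomials n s"
  have img: "(\<lambda>e. g (curve_weight n m e)) ` monomials n s = g ` ?w" by auto
  have "finite ?w"
    using curve_weight_le[where m = m, OF _ le] by (auto intro!: finite_subset[of _ "{..s * m n}"])
  then have fin: "finite ((\<lambda>e. g (curve_weight n m e)) ` monomials n s)"
    unfolding img by simp
  have part: "homogeneous_part n s = {p :: (nat, 'k) mpoly. Poly_Mapping.keys p \<subseteq> monomials n s}"
    by (auto simp: homogeneous_part_def polyring_def monomials_def)
  have space: "homogeneous_space n s = (supported_space (monomials n s) :: ('k, (nat, 'k) mpoly) module)"
    by (simp add: homogeneous_space_def supported_space_def part)
  have ideal: "curve_ideal n m \<inter> homogeneous_part n s =
      {p :: (nat, 'k) mpoly. Poly_Mapping.keys p \<subseteq> monomials n s \<and> msubst (curve_param n m) p = 0}"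
    unfolding part by (auto simp: curve_ideal_def polyring_def monomials_def)
  have "hilbert_function n (curve_ideal n m :: (nat, 'k) mpoly set) s
      = card ((\<lambda>e. g (curve_weight n m e)) ` monomials n s)"
    unfolding hilbert_function_def space ideal
    by (rule dim_quotient_msubst_kernel[OF _ fin]) (simp only: prod_curve_param[where m = m, OF _ le] g_def)
  then show ?thesis
    using card_image[OF inj_on_subset[OF inj subset_UNIV]] by (simp only: img)
qed

section \<open>The weights for an arithmetic sequence\<close>

text \<open>Any \<open>l\<close> up to \<open>j * (n - 1)\<close> is a sum of \<open>j\<close>
  numbers between 0 and \<open>n - 1\<close>, found greedily; the variable of index \<open>i\<close>
  stands for the summand \<open>i - 1\<close>.\<close>

lemma exists_exponents:
  fixes n j l :: nat
  assumes "n \<ge> 1" "l \<le> j * (n - 1)"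
  shows "\<exists>e :: nat \<Rightarrow>\<^sub>0 nat. Poly_Mapping.keys e \<subseteq> {1..n} \<and> (\<Sum>i=1..n. Poly_Mapping.lookup e i) = j \<and>
    (\<Sum>i=1..n. Poly_Mapping.lookup e i * (i - 1)) = l"
  using assms(2)
proof (induction j arbitrary: l)
  case 0
  then show ?case by (intro exI[of _ 0]) simp
next
  case (Suc j)
  \<comment> \<open>The largest summand possible, so that the remainder fits into \<open>j\<close>
    summands. It is realized by the variable of index \<open>b + 1\<close>.\<close>
  define b where "b = min l (n - 1)"
  have "l - b \<le> j * (n - 1)" using Suc.prems by (auto simp: b_def)
  then obtain e where e: "Poly_Mapping.keys e \<subseteq> {1..n}" "(\<Sum>i=1..n. Poly_Mapping.lookup e i) = j"
    "(\<Sum>i=1..n. Poly_Mapping.lookup e i * (i - 1)) = l - b"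
    using Suc.IH by blast
  have b: "b + 1 \<in> {1..n}" "b \<le> l" using \<open>n \<ge> 1\<close> by (auto simp: b_def)
  have delta: "(\<Sum>i=1..n. Poly_Mapping.lookup (Poly_Mapping.single (b + 1) 1) i * h i) = h (b + 1)"
    for h :: "nat \<Rightarrow> nat"
  proof -
    have "(\<Sum>i=1..n. Poly_Mapping.lookup (Poly_Mapping.single (b + 1) 1) i * h i)
        = (\<Sum>i=1..n. if i = b + 1 then h (b + 1) else 0)"
      by (intro sum.cong) (auto simp: lookup_single)
    then show ?thesis using b(1) by simp
  qed
  have "Poly_Mapping.keys (e + Poly_Mapping.single (b + 1) 1) \<subseteq> {1..n}"
    using e(1) b(1) by (intro order.trans[OF keys_add]) auto
  moreover have "(\<Sum>i=1..n. Poly_Mapping.lookup (e + Poly_Mapping.single (b + 1) 1) i) = Suc j"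
    using e(2) delta[of "\<lambda>_. 1"] by (simp add: lookup_add sum.distrib)
  moreover have "(\<Sum>i=1..n. Poly_Mapping.lookup (e + Poly_Mapping.single (b + 1) 1) i * (i - 1)) = l"
    using e(3) delta[of "\<lambda>i. i - 1"] b(2) by (simp add: lookup_add sum.distrib distrib_right)
  ultimately show ?case by blast
qed

text \<open>Here \<open>j\<close> is the degree of the monomial in the first \<open>n\<close>
  variables and \<open>l\<close> is the sum of the offsets \<open>i - 1\<close>, counted with
  multiplicity.\<close>

lemma curve_weight_image:
  assumes "n \<ge> 1" and m: "\<And>i. i \<in> {1..n} \<Longrightarrow> m i = a + (i - 1) * d"
  shows "curve_weight n m ` monomials n s = {j * a + l * d | j l. j \<le> s \<and> l \<le> j * (n - 1)}"
proof -
  have weight: "curve_weight n m e = (\<Sum>i=1..n. Poly_Mapping.lookup e i) * a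
      + (\<Sum>i=1..n. Poly_Mapping.lookup e i * (i - 1)) * d" for e
    by (simp add: curve_weight_def m sum_distrib_right sum.distrib distrib_left mult.assoc)
  show ?thesis
  proof (intro equalityI subsetI)
    fix x assume "x \<in> curve_weight n m ` monomials n s"
    then obtain e where e: "e \<in> monomials n s" "x = curve_weight n m e" by auto
    have "(\<Sum>i=1..n. Poly_Mapping.lookup e i * (i - 1)) \<le> (\<Sum>i=1..n. Poly_Mapping.lookup e i * (n - 1))"
      by (intro sum_mono mult_left_mono) auto
    then have "(\<Sum>i=1..n. Poly_Mapping.lookup e i * (i - 1)) \<le> (\<Sum>i=1..n. Poly_Mapping.lookup e i) * (n - 1)"
      by (simp add: sum_distrib_right)
    moreover have "(\<Sum>i=1..n. Poly_Mapping.lookup e i) \<le> s"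
      using e(1) by (auto simp: monomials_def mon_degree_eq_sum)
    ultimately show "x \<in> {j * a + l * d | j l. j \<le> s \<and> l \<le> j * (n - 1)}"
      unfolding e(2) weight by blast
  next
    fix x assume "x \<in> {j * a + l * d | j l. j \<le> s \<and> l \<le> j * (n - 1)}"
    then obtain j l where jl: "x = j * a + l * d" "j \<le> s" "l \<le> j * (n - 1)" by auto
    obtain e where e: "Poly_Mapping.keys e \<subseteq> {1..n}" "(\<Sum>i=1..n. Poly_Mapping.lookup e i) = j"
      "(\<Sum>i=1..n. Poly_Mapping.lookup e i * (i - 1)) = l"
      using exists_exponents[OF assms(1) jl(3)] by blast
    \<comment> \<open>The last variable has weight 0 and pads the degree from \<open>j\<close> to
      \<open>s\<close>.\<close>
    define f where "f = e + Poly_Mapping.single (n + 1) (s - j)"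
    have f: "Poly_Mapping.lookup f i = Poly_Mapping.lookup e i" if "i \<in> {1..n}" for i
      using that by (simp add: f_def lookup_add lookup_single)
    have keys: "Poly_Mapping.keys f \<subseteq> {1..n+1}"
      unfolding f_def using e(1) by (intro order.trans[OF keys_add]) auto
    have "Poly_Mapping.lookup e (n + 1) = 0"
      using e(1) by (auto simp: in_keys_iff)
    then have "mon_degree f = s"
      using jl(2) e(2) f by (simp add: mon_degree_eq_sum[OF keys]) (simp add: f_def lookup_add)
    then have "f \<in> monomials n s" using keys by (simp add: monomials_def)
    moreover have "curve_weight n m f = x"
      using f e jl(1) by (simp add: weight)
    ultimately show "x \<in> curve_weight n m ` monomials n s" by blast
  qed
qed

section \<open>Counting the weights\<close>

text \<open>The shift from \<open>(j, l)\<close> to \<open>(j - d, l + a)\<close> preserves the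
  value \<open>j * a + l * d\<close>. Each value is counted at the one admissible pair from which no
  further shift is possible.\<close>

lemma card_progression_sums:
  fixes a d N q r s :: nat
  assumes "coprime a d" "d > 0" "a = q * N + r" "r \<ge> 1" "r \<le> N"
  shows "card {j * a + l * d | j l. j \<le> s \<and> l \<le> j * N}
    = (\<Sum>j\<le>s. if j \<le> q + d then j * N + 1 else (q + d) * N + r)"
proof -
  \<comment> \<open>The \<open>l\<close> for which the shift is blocked: \<open>j < d\<close>, or
    \<open>l + a\<close> exceeds \<open>(j - d) * N\<close>. The condition is written without
    subtraction, using \<open>a + d * N = r + (q + d) * N\<close>.\<close>
  define L where "L j = {l. l \<le> j * N \<and> j * N < l + r + (q + d) * N}" for j
  let ?f = "\<lambda>(j, l). j * a + l * d"
  have L_iff: "l \<in> L j \<longleftrightarrow> l \<le> j * N \<and> j * N < l + a + d * N" for l j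
    by (simp add: L_def assms(3) algebra_simps)
  have less: False if "j < j'" "l \<in> L j" "l' \<in> L j'" "j * a + l * d = j' * a + l' * d" for j j' l l'
  proof -
    obtain u where u: "j' = j + u" "u > 0" using \<open>j < j'\<close> less_imp_add_positive by blast
    with that(4) have eq: "l * d = u * a + l' * d" by (simp add: algebra_simps)
    \<comment> \<open>Coprimality makes the two pairs differ by \<open>t\<close> whole
      shifts.\<close>
    then have "d dvd u * a" by (metis dvd_add_left_iff dvd_triv_right)
    then have "d dvd u" using assms(1) coprime_commute coprime_dvd_mult_left_iff by blast
    then obtain t where t: "u = d * t" by blast
    with u(2) have "t \<ge> 1" by (cases t) auto
    have "l * d = (t * a + l') * d" using eq t by (simp add: algebra_simps)
    then have l: "l = t * a + l'" using \<open>d > 0\<close> by simp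
    \<comment> \<open>Admissibility of \<open>(j, l)\<close> means that \<open>t\<close> shifts from
      \<open>(j', l')\<close> are possible. As \<open>t \<ge> 1\<close>, one shift is possible too,
      against \<open>l' \<in> L j'\<close>.\<close>
    have "t * a + l' \<le> j * N" using that(2) l by (simp add: L_iff)
    then have "t * (a + d * N) + l' \<le> j' * N" using u t by (simp add: algebra_simps)
    moreover have "a + d * N \<le> t * (a + d * N)" using \<open>t \<ge> 1\<close> by simp
    ultimately show False using that(3) unfolding L_iff by linarith
  qed
  have inj: "inj_on ?f (Sigma {..s} L)"
  proof (rule inj_onI, clarsimp)
    fix j l j' l'
    assume h: "l \<in> L j" "l' \<in> L j'" "j * a + l * d = j' * a + l' * d"
    then have "j = j'" using less by (metis linorder_neqE_nat)
    then show "j = j' \<and> l = l'" using h(3) \<open>d > 0\<close> by simp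
  qed
  have img: "?f ` Sigma {..s} L = {j * a + l * d | j l. j \<le> s \<and> l \<le> j * N}"
  proof -
    have "\<exists>j' l'. j' \<le> j \<and> l' \<in> L j' \<and> j' * a + l' * d = j * a + l * d" if "l \<le> j * N" for j l
      using that
    proof (induction j arbitrary: l rule: less_induct)
      case (less j)
      show ?case
      proof (cases "l \<in> L j")
        case False
        \<comment> \<open>Outside \<open>L j\<close> the shift is admissible and lowers
          \<open>j\<close>, so repeating it reaches a blocked pair of the same value.\<close>
        then have le: "l + a + d * N \<le> j * N" using less.prems by (simp add: L_iff)
        then have "d * N \<le> j * N" by linarith
        then have "d \<le> j" using assms by simp
        then obtain k where k: "j = d + k" using le_Suc_ex by blast
        with le have "l + a \<le> k * N" by (simp add: algebra_simps)
        moreover have "k < j" using k \<open>d > 0\<close> by simp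
        ultimately obtain j' l' where "j' \<le> k" "l' \<in> L j'" "j' * a + l' * d = k * a + (l + a) * d"
          using less.IH by blast
        then show ?thesis using k by (intro exI[of _ j'] exI[of _ l']) (simp add: algebra_simps)
      qed blast
    qed
    then show ?thesis
      by (fastforce simp: L_def image_iff)
  qed
  have "card {j * a + l * d | j l. j \<le> s \<and> l \<le> j * N} = card (Sigma {..s} L)"
    using card_image[OF inj] unfolding img .
  also have "\<dots> = (\<Sum>j\<le>s. card (L j))"
    by (rule card_SigmaI) (auto simp: L_def)
  also have "\<dots> = (\<Sum>j\<le>s. if j \<le> q + d then j * N + 1 else (q + d) * N + r)"
  proof (rule sum.cong)
    fix j
    show "card (L j) = (if j \<le> q + d then j * N + 1 else (q + d) * N + r)"
    proof (cases "j \<le> q + d")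
      case True
      \<comment> \<open>For these \<open>j\<close> the strict bound holds for every
        \<open>l\<close>, because \<open>r \<ge> 1\<close>.\<close>
      then have "j * N \<le> (q + d) * N" by (rule mult_right_mono) simp
      then have "j * N < l + r + (q + d) * N" for l using \<open>r \<ge> 1\<close> by linarith
      then have "L j = {..j * N}" by (auto simp: L_def)
      then show ?thesis using True by simp
    next
      case False
      \<comment> \<open>Together with \<open>r \<le> N\<close> this keeps the lower end of the
        interval from being truncated, so its length is the same for all such
        \<open>j\<close>.\<close>
      then have "Suc (q + d) * N \<le> j * N" by (intro mult_right_mono) auto
      then have "r + (q + d) * N \<le> j * N" using \<open>r \<le> N\<close> by simp
      moreover have "L j = {j * N + 1 - (r + (q + d) * N)..j * N}" by (auto simp: L_def)
      ultimately show ?thesis using False by simp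
    qed
  qed simp
  finally show ?thesis .
qed

section \<open>The generating function\<close>

lemma fps_partial_sums_progression:
  fixes N \<alpha> r :: nat
  assumes "r \<ge> 1"
  shows "Abs_fps (\<lambda>s. of_nat (\<Sum>j\<le>s. if j \<le> \<alpha> then j * N + 1 else \<alpha> * N + r)) =
    (1 + of_nat N * (\<Sum>j=1..\<alpha>. fps_X ^ j) + of_nat (r - 1) * fps_X ^ (\<alpha> + 1) :: rat fps)
      / (1 - fps_X)\<^sup>2"
proof -
  let ?c = "\<lambda>j. if j \<le> \<alpha> then j * N + 1 else \<alpha> * N + r"
  let ?F = "Abs_fps (\<lambda>s. of_nat (\<Sum>j\<le>s. ?c j)) :: rat fps"
  let ?P = "1 + of_nat N * (\<Sum>j=1..\<alpha>. fps_X ^ j) + of_nat (r - 1) * fps_X ^ (\<alpha> + 1) :: rat fps"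
  \<comment> \<open>Multiplication by \<open>1 - fps_X\<close> takes backward differences: the first
    factor undoes the partial sums, the second differences the summands \<open>?c\<close>.\<close>
  have diff: "fps_nth (G * (1 - fps_X)) s = (if s = 0 then fps_nth G 0 else fps_nth G s - fps_nth G (s - 1))"
    for G :: "rat fps" and s
    by (simp add: algebra_simps)
  have "?F * (1 - fps_X) = Abs_fps (\<lambda>s. of_nat (?c s))"
  proof (rule fps_ext)
    fix s show "fps_nth (?F * (1 - fps_X)) s = fps_nth (Abs_fps (\<lambda>s. of_nat (?c s) :: rat)) s"
      unfolding diff by (cases s) simp_all
  qed
  \<comment> \<open>The sequence \<open>?c\<close> starts at 1, grows by \<open>N\<close> up to
    index \<alpha>, then by \<open>(\<alpha> * N + r) - (\<alpha> * N + 1) = r - 1\<close>, and is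
    constant afterwards.\<close>
  moreover have "Abs_fps (\<lambda>s. of_nat (?c s)) * (1 - fps_X) = ?P"
  proof (rule fps_ext)
    fix s
    have "fps_nth (\<Sum>j=1..\<alpha>. fps_X ^ j :: rat fps) s = (if s \<in> {1..\<alpha>} then 1 else 0)"
      by (simp add: fps_sum_nth fps_X_power_nth)
    then have "fps_nth ?P s = (if s = 0 then 1 else 0) + of_nat N * (if s \<in> {1..\<alpha>} then 1 else 0)
        + of_nat (r - 1) * (if s = \<alpha> + 1 then 1 else 0)"
      by (auto simp: fps_mult_of_nat_nth(1) fps_X_power_nth)
    also have "\<dots> = fps_nth (Abs_fps (\<lambda>s. of_nat (?c s)) * (1 - fps_X)) s"
      unfolding diff using assms by (cases s) (auto simp: of_nat_diff algebra_simps not_le le_Suc_eq)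
    finally show "fps_nth (Abs_fps (\<lambda>s. of_nat (?c s)) * (1 - fps_X)) s = fps_nth ?P s" ..
  qed
  ultimately have P: "?F * (1 - fps_X)\<^sup>2 = ?P"
    by (simp only: power2_eq_square mult.assoc[symmetric])
  have "fps_nth (1 - fps_X :: rat fps) 0 \<noteq> 0" by simp
  then have "(1 - fps_X :: rat fps) \<noteq> 0" by (intro notI) simp
  then have "(1 - fps_X :: rat fps)\<^sup>2 \<noteq> 0" by (rule power_not_zero)
  then have "?F = ?F * (1 - fps_X)\<^sup>2 / (1 - fps_X)\<^sup>2"
    by (rule nonzero_mult_div_cancel_right[symmetric])
  then show ?thesis unfolding P .
qed

section \<open>The Hilbert series of the curve\<close>

theorem theorem2p9:
  fixes n d q r \<alpha> k :: nat and m :: "nat \<Rightarrow> nat"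
  assumes "infinite (UNIV :: 'k::field set)"
    and "n \<ge> 2"
    and "\<forall>i\<in>{1..n}. m i > 0"
    and "d > 0"
    and "\<forall>i\<in>{1..n}. m i = m 1 + (i - 1) * d"
    and "gcd (m 1) d = 1"
    and "r \<in> {1..n - 1}"
    and "m 1 = q * (n - 1) + r"
    and "\<alpha> = q + d"
    and "k = n - r"
  shows "hilbert_series n (curve_ideal n m :: (nat, 'k) mpoly set) =
    (1 + of_nat (n - 1) * (\<Sum>j=1..\<alpha>. fps_X ^ j) + of_nat (n - 1 - k) * fps_X ^ (\<alpha> + 1))
      / (1 - fps_X)\<^sup>2"
proof -
  have m: "m i = m 1 + (i - 1) * d" if "i \<in> {1..n}" for i
    using assms that by blast
  have le: "m i \<le> m n" if "i \<in> {1..n}" for i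
  proof -
    have "(i - 1) * d \<le> (n - 1) * d" using that by (intro mult_right_mono) auto
    then show ?thesis using m[of i] m[of n] that by simp
  qed
  have cop: "coprime (m 1) d" using assms(6) by (simp add: coprime_iff_gcd_eq_1)
  have r: "1 \<le> r" "r \<le> n - 1" using assms(7) by auto
  have card: "hilbert_function n (curve_ideal n m :: (nat, 'k) mpoly set) s
      = (\<Sum>j\<le>s. if j \<le> \<alpha> then j * (n - 1) + 1 else \<alpha> * (n - 1) + r)" for s
  proof -
    have "hilbert_function n (curve_ideal n m :: (nat, 'k) mpoly set) s
        = card (curve_weight n m ` monomials n s)"
      by (rule hilbert_function_curve_ideal) (rule le)
    also have "curve_weight n m ` monomials n s
        = {j * m 1 + l * d | j l. j \<le> s \<and> l \<le> j * (n - 1)}"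
      by (rule curve_weight_image) (use \<open>n \<ge> 2\<close> in simp, rule m)
    also have "card \<dots> = (\<Sum>j\<le>s. if j \<le> \<alpha> then j * (n - 1) + 1 else \<alpha> * (n - 1) + r)"
      unfolding \<open>\<alpha> = q + d\<close> using cop \<open>d > 0\<close> assms(8) r
      by (rule card_progression_sums)
    finally show ?thesis .
  qed
  \<comment> \<open>Since \<open>k = n - r\<close> and \<open>1 \<le> r \<le> n - 1\<close>, no
    subtraction is truncated, and the last jump of the summands is the stated top
    coefficient.\<close>
  have "n - 1 - k = r - 1" using assms(7,10) by auto
  then show ?thesis
    unfolding hilbert_series_def card fps_partial_sums_progression[OF r(1)] by (simp only:)
qed

end
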